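(* Let $p$ be prime, $n\ge1$, and let $f$, $\lambda$, $e_j$, $f_k$ be as in the context. Let $M:V_2(GF(p^n))\to V_{2n}(\mathbb{Z}_p)$ be the $\mathbb{Z}_p$-linear map sending $e_j$ to the vector with a $1$ in position $2j$ and zeros elsewhere, and $f_j$ to the vector with a $1$ in position $2j+1$ and zeros elsewhere (positions indexed from $0$). Then $M$ is a $\mathbb{Z}_p$-linear isomorphism and for all $u_1,u_2\in V_2(GF(p^n))$, $$M(u_1)\circ M(u_2)=\operatorname{Tr}(u_1\circ u_2).$$ Consequently the images $M(C_\alpha)$, $\alpha\in GF(p^n)$, and $M(C_\infty)$ are $p^n+1$ subspaces of $V_{2n}(\mathbb{Z}_p)$, each of size $p^n$, pairwise intersecting only in $0$, within each of which all symplectic products vanish; hence for each such subspace the tensor products $S_{x_0,y_0}\otimes S_{x_1,y_1}\otimes\cdots\otimes S_{x_{n-1},y_{n-1}}$, $(x_0,y_0,\dots,x_{n-1},y_{n-1})$ in the subspace, pairwise commute.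
   Context: $f(x)=c_0+\cdots+c_{n-1}x^{n-1}+x^n$ is irreducible over $\mathbb{Z}_p$ with $n$ distinct roots $\lambda_1,\dots,\lambda_n$ in $GF(p^n)$, $\lambda$ one of them; elements of $GF(p^n)$ are $\alpha(\lambda)=\sum_{i<n}a_i\lambda^i$, $a_i\in\mathbb{Z}_p$, and $\operatorname{Tr}(\alpha)=\sum_{r=1}^n\alpha(\lambda_r)$. $d_j(\lambda)$ are defined by $f(x)/(x-\lambda)=\sum_{j=0}^{n-1}d_j(\lambda)x^j$; $e_j=d_j(\lambda)f'(\lambda)^{-1}(1,0)$ and $f_k=\lambda^k(0,1)$ in $V_2(GF(p^n))=GF(p^n)^2$. Symplectic product on $V_2(GF(p^n))$: $(\alpha,\beta)\circ(\alpha',\beta')=\beta\alpha'-\alpha\beta'$. On $V_{2n}(\mathbb{Z}_p)$, writing $w=(x_0,y_0,\dots,x_{n-1},y_{n-1})$: $w\circ w'=\sum_{i=0}^{n-1}(y_ix_i'-x_iy_i')\bmod p$. $C_\alpha=\{\beta(1,\alpha):\beta\in GF(p^n)\}$, $C_\infty=\{\beta(0,1):\beta\in GF(p^n)\}$. $S_{x,y}=\sum_{m=0}^{p-1}\eta^{mx}|m\rangle\langle m+y|$ on $\mathbb{C}^p$, $\eta=\exp(2\pi i/p)$; two tensor products $\bigotimes_iS_{x_i,y_i}$ and $\bigotimes_iS_{x_i',y_i'}$ commute iff $w\circ w'=0$. *)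

theory Defs
  imports "HOL-Analysis.Analysis" "HOL-Computational_Algebra.Polynomial" "Berlekamp_Zassenhaus.Finite_Field"
begin

text \<open>Z_p is the type 'p mod_ring (CARD('p) = p prime).  GF(p^n) is an abstract finite
field type 'k with p^n elements and characteristic p.  emb is the canonical
embedding of Z_p into GF(p^n).\<close>

definition emb :: "'p::prime_card mod_ring \<Rightarrow> 'k::field" where
  "emb c = of_int (to_int_mod_ring c)"

definition fK :: "'p::prime_card mod_ring poly \<Rightarrow> 'k::field poly" where
  "fK f = map_poly emb f"

definition gf_rep :: "'p::prime_card mod_ring poly \<Rightarrow> 'k::field \<Rightarrow> 'k \<Rightarrow> 'p mod_ring poly" where
  "gf_rep f lam \<alpha> = (THE a. degree a < degree f \<and> poly (map_poly emb a) lam = \<alpha>)"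

definition gf_tr :: "'p::prime_card mod_ring poly \<Rightarrow> 'k::field \<Rightarrow> 'k \<Rightarrow> 'k" where
  "gf_tr f lam \<alpha> = (\<Sum>\<rho>\<in>{\<rho>. poly (fK f) \<rho> = 0}. poly (map_poly emb (gf_rep f lam \<alpha>)) \<rho>)"

definition dcoef :: "'p::prime_card mod_ring poly \<Rightarrow> 'k::field \<Rightarrow> nat \<Rightarrow> 'k" where
  "dcoef f lam j = Polynomial.coeff (fK f div [:- lam, 1:]) j"

definition evec :: "'p::prime_card mod_ring poly \<Rightarrow> 'k::field \<Rightarrow> nat \<Rightarrow> 'k \<times> 'k" where
  "evec f lam j = (dcoef f lam j * inverse (poly (pderiv (fK f)) lam), 0)"

definition fvec :: "'k::field \<Rightarrow> nat \<Rightarrow> 'k \<times> 'k" where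
  "fvec lam k = (0, lam ^ k)"

definition symK :: "'k::field \<times> 'k \<Rightarrow> 'k \<times> 'k \<Rightarrow> 'k" where
  "symK u v = snd u * fst v - fst u * snd v"

text \<open>V_{2n}(Z_p): vectors (x_0,y_0,...,x_{n-1},y_{n-1}) as functions nat => Z_p,
  position 2i holds x_i, position 2i+1 holds y_i, zero from position 2n on\<close>
definition V2n :: "nat \<Rightarrow> (nat \<Rightarrow> 'p::prime_card mod_ring) set" where
  "V2n n = {w. \<forall>i\<ge>2*n. w i = 0}"

definition unitv :: "nat \<Rightarrow> nat \<Rightarrow> 'p::prime_card mod_ring" where
  "unitv k = (\<lambda>i. if i = k then 1 else 0)"

definition symZ :: "nat \<Rightarrow> (nat \<Rightarrow> 'p::prime_card mod_ring) \<Rightarrow> (nat \<Rightarrow> 'p mod_ring) \<Rightarrow> 'p mod_ring" where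
  "symZ n w w' = (\<Sum>i<n. w (2*i+1) * w' (2*i) - w (2*i) * w' (2*i+1))"

definition Zp_linear :: "('k::field \<times> 'k \<Rightarrow> nat \<Rightarrow> 'p::prime_card mod_ring) \<Rightarrow> bool" where
  "Zp_linear M \<longleftrightarrow>
     (\<forall>u v. M (fst u + fst v, snd u + snd v) = (\<lambda>i. M u i + M v i)) \<and>
     (\<forall>c u. M (emb c * fst u, emb c * snd u) = (\<lambda>i. c * M u i))"

definition Zp_subspace :: "nat \<Rightarrow> (nat \<Rightarrow> 'p::prime_card mod_ring) set \<Rightarrow> bool" where
  "Zp_subspace n W \<longleftrightarrow> W \<subseteq> V2n n \<and> (\<lambda>i. 0) \<in> W \<and>
     (\<forall>w\<in>W. \<forall>w'\<in>W. (\<lambda>i. w i + w' i) \<in> W) \<and> (\<forall>c. \<forall>w\<in>W. (\<lambda>i. c * w i) \<in> W)"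

definition Cset :: "'k::field option \<Rightarrow> ('k \<times> 'k) set" where
  "Cset oa = (case oa of Some \<alpha> \<Rightarrow> {(\<beta>, \<beta> * \<alpha>) | \<beta>. True} | None \<Rightarrow> {(0, \<beta>) | \<beta>. True})"

text \<open>S_{x,y} = sum_m eta^{m x} |m><m+y| as a p x p matrix indexed by {0..<p}:
  entry (m, m') is eta^{m x} if m' = m + y mod p, else 0\<close>
definition Sop :: "'p::prime_card mod_ring \<Rightarrow> 'p mod_ring \<Rightarrow> nat \<Rightarrow> nat \<Rightarrow> complex" where
  "Sop x y m m' = (if m' = (m + nat (to_int_mod_ring y)) mod CARD('p)
      then cis (2 * pi * real m * real_of_int (to_int_mod_ring x) / real CARD('p)) else 0)"

text \<open>index set of the tensor product (C^p)^{\<otimes> n}: tuples (m_0,...,m_{n-1})\<close>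
definition tidx :: "nat \<Rightarrow> nat \<Rightarrow> (nat \<Rightarrow> nat) set" where
  "tidx n p = {ms. \<forall>i. (i < n \<longrightarrow> ms i < p) \<and> (n \<le> i \<longrightarrow> ms i = 0)}"

definition tensorS :: "nat \<Rightarrow> (nat \<Rightarrow> 'p::prime_card mod_ring) \<Rightarrow> (nat \<Rightarrow> nat) \<Rightarrow> (nat \<Rightarrow> nat) \<Rightarrow> complex" where
  "tensorS n w ms ms' = (\<Prod>i<n. Sop (w (2*i)) (w (2*i+1)) (ms i) (ms' i))"

definition tmult :: "(nat \<Rightarrow> nat) set \<Rightarrow> ((nat \<Rightarrow> nat) \<Rightarrow> (nat \<Rightarrow> nat) \<Rightarrow> complex)
   \<Rightarrow> ((nat \<Rightarrow> nat) \<Rightarrow> (nat \<Rightarrow> nat) \<Rightarrow> complex) \<Rightarrow> (nat \<Rightarrow> nat) \<Rightarrow> (nat \<Rightarrow> nat) \<Rightarrow> complex" where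
  "tmult I A B a b = (\<Sum>k\<in>I. A a k * B k b)"

definition ops_commute :: "nat \<Rightarrow> nat \<Rightarrow> ((nat \<Rightarrow> nat) \<Rightarrow> (nat \<Rightarrow> nat) \<Rightarrow> complex)
   \<Rightarrow> ((nat \<Rightarrow> nat) \<Rightarrow> (nat \<Rightarrow> nat) \<Rightarrow> complex) \<Rightarrow> bool" where
  "ops_commute n p A B \<longleftrightarrow> (\<forall>a\<in>tidx n p. \<forall>b\<in>tidx n p.
      tmult (tidx n p) A B a b = tmult (tidx n p) B A a b)"

end

theory Submission
  imports Defs
begin

text \<open>
  Since \<open>f\<close> divides \<open>X\<^sup>q - X\<close> over \<open>Z\<^sub>p\<close>, where \<open>q = p\<^sup>n\<close> is the order of the field, it has \<open>n\<close>
  distinct roots \<open>\<rho>\<close>, and \<open>\<lambda> \<mapsto> \<rho>\<close> extends to a field homomorphism for each of them. Lagrange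
  interpolation of \<open>X\<^sup>k\<close> at these roots says that \<open>d\<^sub>j(\<lambda>) / f'(\<lambda>)\<close> is the trace-dual basis of
  \<open>\<lambda>\<^sup>k\<close>. Hence \<open>M\<close> takes coordinates with respect to a pair of dual bases, which turns the trace of
  the symplectic product into the standard symplectic product. The sets \<open>C\<^sub>\<alpha>\<close> are the lines through the
  origin, on which the symplectic product over the field already vanishes. Products of the
  operators \<open>S\<close> in the two orders differ by the phase \<open>\<eta>\<close> to the power \<open>w \<circ> w'\<close>.
\<close>

section \<open>Powers in a finite field and Lagrange interpolation at roots\<close>

text \<open>Multiplication by a nonzero \<open>x\<close> permutes the nonzero elements, so it
  preserves their product, which can be cancelled.\<close>

lemma finite_field_power_card:
  fixes x :: "'k::{field,finite}"
  shows "x ^ CARD('k) = x"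
proof (cases "x = 0")
  case True
  then show ?thesis by (simp add: zero_power)
next
  case False
  let ?U = "UNIV - {0::'k}"
  have "bij_betw ((*) x) ?U ?U"
    by (rule bij_betwI[where g = "\<lambda>y. y / x"]) (use False in auto)
  then have "prod ((*) x) ?U = \<Prod>?U"
    by (rule prod.reindex_bij_betw[where g = "\<lambda>y. y", simplified])
  then have "x ^ card ?U * \<Prod>?U = 1 * \<Prod>?U"
    by (simp add: prod.distrib)
  then have "x ^ card ?U = 1"
    by (subst (asm) mult_right_cancel) auto
  moreover have "CARD('k) = Suc (card ?U)"
    using card_Suc_Diff1[of UNIV "0::'k"] by simp
  ultimately show ?thesis by (simp only: power_Suc mult_1_right)
qed

text \<open>The quotients of \<open>F\<close> by \<open>X - \<rho>\<close>, divided by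
  \<open>F'(\<rho>)\<close>, are the Lagrange basis polynomials at the roots. Interpolate
  \<open>X^k\<close> and compare coefficients of \<open>X^j\<close>.\<close>

lemma euler_interpolation:
  fixes F :: "'k::field poly"
  assumes split: "card {x. poly F x = 0} = degree F"
    and sep: "\<And>\<rho>. poly F \<rho> = 0 \<Longrightarrow> poly (pderiv F) \<rho> \<noteq> 0"
    and k: "k < degree F"
  shows "(\<Sum>\<rho>\<in>{\<rho>. poly F \<rho> = 0}.
            Polynomial.coeff (F div [:- \<rho>, 1:]) j * inverse (poly (pderiv F) \<rho>) * \<rho> ^ k)
         = (if j = k then 1 else 0)"
proof -
  let ?R = "{\<rho>. poly F \<rho> = 0}"
  define Q where "Q \<rho> = F div [:- \<rho>, 1:]" for \<rho>
  define P where
    "P = (\<Sum>\<rho>\<in>?R. Polynomial.smult (inverse (poly (pderiv F) \<rho>) * \<rho> ^ k) (Q \<rho>))"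
  have F0: "F \<noteq> 0" using k by auto
  have fin: "finite ?R" by (rule poly_roots_finite[OF F0])
  have FQ: "F = [:- \<rho>, 1:] * Q \<rho>" if "\<rho> \<in> ?R" for \<rho>
    using that unfolding Q_def poly_eq_0_iff_dvd by (simp only: mem_Collect_eq dvd_mult_div_cancel)
  have evalQ: "poly (Q \<rho>) \<tau> = (if \<tau> = \<rho> then poly (pderiv F) \<rho> else 0)"
    if "\<rho> \<in> ?R" "\<tau> \<in> ?R" for \<rho> \<tau>
  proof (cases "\<tau> = \<rho>")
    case True
    have "pderiv F = [:- \<rho>, 1:] * pderiv (Q \<rho>) + Q \<rho>"
      by (subst FQ[OF that(1)], subst pderiv_mult) (simp add: pderiv_pCons)
    then show ?thesis using True by simp
  next
    case False
    have "0 = poly ([:- \<rho>, 1:] * Q \<rho>) \<tau>"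
      using that(2) FQ[OF that(1)] by simp
    then show ?thesis using False by simp
  qed
  have degQ: "degree (Q \<rho>) < degree F" if "\<rho> \<in> ?R" for \<rho>
  proof -
    have "Q \<rho> \<noteq> 0" using FQ[OF that] F0 by auto
    then have "degree F = 1 + degree (Q \<rho>)"
      by (subst FQ[OF that], subst degree_mult_eq) auto
    then show ?thesis by simp
  qed
  \<comment> \<open>Both sides have degree below \<open>card ?R\<close>, so agreement on the roots
    is enough.\<close>
  have "P = Polynomial.monom 1 k"
  proof (rule poly_eqI_degree[where A = ?R])
    fix \<tau> assume \<tau>: "\<tau> \<in> ?R"
    have "poly P \<tau> = (\<Sum>\<rho>\<in>?R. if \<tau> = \<rho> then \<tau> ^ k else 0)"
      unfolding P_def poly_sum
      by (rule sum.cong) (use \<tau> sep in \<open>auto simp: evalQ\<close>)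
    also have "\<dots> = \<tau> ^ k" using fin \<tau> by (simp add: sum.delta')
    finally show "poly P \<tau> = poly (Polynomial.monom 1 k) \<tau>"
      by (simp add: poly_monom)
  next
    have "degree P \<le> degree F - 1" unfolding P_def
      by (rule degree_sum_le[OF fin])
         (use degQ in \<open>fastforce intro: order_trans[OF degree_smult_le]\<close>)
    then show "degree P < card ?R" using k split by simp
  next
    show "degree (Polynomial.monom (1::'k) k) < card ?R"
      using k split by (simp add: degree_monom_eq)
  qed
  then have "Polynomial.coeff P j = (if j = k then 1 else 0)" by simp
  then show ?thesis unfolding P_def Q_def
    by (simp add: coeff_sum mult_ac)
qed

section \<open>Lines through the origin of the plane over the field\<close>

text \<open>Up to sign, \<open>symK\<close> is the determinant of two vectors, and vectors on one
  line are dependent.\<close>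

lemma symK_Cset: "u \<in> Cset a \<Longrightarrow> v \<in> Cset a \<Longrightarrow> symK u v = 0"
  by (cases a) (auto simp: Cset_def symK_def)

lemma Cset_0: "0 \<in> Cset a"
  by (cases a) (auto simp: Cset_def zero_prod_def)

lemma Cset_add: "u \<in> Cset a \<Longrightarrow> v \<in> Cset a \<Longrightarrow> u + v \<in> Cset a"
  by (cases a) (auto simp: Cset_def distrib_right)

lemma Cset_scale: "u \<in> Cset a \<Longrightarrow> (c * fst u, c * snd u) \<in> Cset a"
  by (cases a) (auto simp: Cset_def)

lemma Cset_inter: "a \<noteq> b \<Longrightarrow> Cset a \<inter> Cset b = {0}"
  by (cases a; cases b) (auto simp: Cset_def zero_prod_def)

lemma card_Cset: "card (Cset (a :: 'k::field option)) = CARD('k)"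
proof (cases a)
  case None
  then have "Cset a = Pair 0 ` UNIV" by (auto simp: Cset_def)
  then show ?thesis by (simp add: card_image inj_on_def)
next
  case (Some \<alpha>)
  then have "Cset a = (\<lambda>\<beta>. (\<beta>, \<beta> * \<alpha>)) ` UNIV" by (auto simp: Cset_def)
  then show ?thesis by (simp add: card_image inj_on_def)
qed

section \<open>The embedding of \<open>Z_p\<close> and the minimal polynomial of
  \<open>lam\<close>\<close>

text \<open>Since p is zero in the field, reducing an integer mod p does not change its image; hence
  taking representatives respects sums and products.\<close>

lemma field_hom_emb:
  assumes "of_nat CARD('p::prime_card) = (0::'k::field)"
  shows "field_hom (emb :: 'p mod_ring \<Rightarrow> 'k)"
proof -
  have "of_int (x mod int CARD('p)) = (of_int x :: 'k)" for x
  proof -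
    have "(of_int x :: 'k) = of_int (x div int CARD('p) * int CARD('p) + x mod int CARD('p))"
      by simp
    also have "\<dots> = of_int (x mod int CARD('p))"
      using assms by (simp only: of_int_add of_int_mult of_int_of_nat_eq) simp
    finally show ?thesis ..
  qed
  then show ?thesis
    by unfold_locales (simp_all add: emb_def to_int_mod_ring_add to_int_mod_ring_mult)
qed

text \<open>The hypotheses of the theorem. That \<open>f\<close> has \<open>n\<close> distinct roots
  in the field is derived from them in \<open>roots_separable\<close>.\<close>

locale gf_extension =
  fixes f :: "'p::prime_card mod_ring poly" and lam :: "'k::{field,finite}"
  assumes irr: "irreducible f" and mon: "monic f"
    and cardK: "CARD('k) = CARD('p) ^ degree f"
    and charK: "of_nat CARD('p) = (0::'k)"
    and root: "poly (fK f) lam = 0"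
begin

sublocale emb: field_hom "emb :: 'p mod_ring \<Rightarrow> 'k"
  by (rule field_hom_emb[OF charK])

sublocale emb_poly: map_poly_inj_idom_hom "emb :: 'p mod_ring \<Rightarrow> 'k" ..

lemma fK_simps:
  fixes a b :: "'p mod_ring poly" and g :: "'i \<Rightarrow> 'p mod_ring poly" and c :: "'p mod_ring"
  shows "fK (a + b) = (fK a + fK b :: 'k poly)" "fK (a - b) = (fK a - fK b :: 'k poly)"
    "fK (a * b) = (fK a * fK b :: 'k poly)" "fK (sum g I) = (\<Sum>i\<in>I. fK (g i) :: 'k poly)"
    "fK (Polynomial.monom c m) = (Polynomial.monom (emb c) m :: 'k poly)"
    "fK (pCons c a) = (pCons (emb c) (fK a) :: 'k poly)"
    "fK (0 :: 'p mod_ring poly) = (0 :: 'k poly)" "fK (1 :: 'p mod_ring poly) = (1 :: 'k poly)"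
  by (simp_all add: fK_def emb_poly.hom_add emb_poly.hom_minus emb_poly.hom_mult
      emb_poly.hom_sum emb.map_poly_pCons_hom)

abbreviation "n \<equiv> degree f"
abbreviation "F \<equiv> fK f :: 'k poly"
abbreviation "R \<equiv> {\<rho>. poly F \<rho> = 0}"

lemma f_nonzero: "f \<noteq> 0" using irr by auto

lemma degree_F: "degree F = n" by (simp add: fK_def)

lemma degree_pos: "0 < n"
proof (rule ccontr)
  assume "\<not> 0 < n"
  then have "is_unit f" using f_nonzero by (simp add: is_unit_iff_degree)
  then show False using irr by (simp add: irreducible_def)
qed

text \<open>If the irreducible \<open>f\<close> does not divide \<open>a\<close>, the two are
  coprime; evaluating a Bezout identity at a common root \<open>lam\<close> would give 0 =
  1.\<close>

lemma dvd_iff_eval_0: "f dvd a \<longleftrightarrow> poly (fK a) lam = 0"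
proof
  assume "f dvd a"
  then obtain b where "a = f * b" ..
  then show "poly (fK a) lam = 0" using root by (simp add: fK_simps)
next
  assume a: "poly (fK a) lam = 0"
  show "f dvd a"
  proof (rule ccontr)
    assume "\<not> f dvd a"
    moreover have "prime_elem f" using irr by (rule irreducible_imp_prime_elem_gcd)
    ultimately have "coprime f a" by (metis prime_elem_imp_coprime)
    then obtain u v where uv: "u * f + v * a = 1"
      by (metis bezout_coefficients_fst_snd coprime_iff_gcd_eq_1)
    have "poly (fK (u * f + v * a)) lam = 0"
      using a root by (simp add: fK_simps)
    then show False by (simp add: uv fK_simps)
  qed
qed

text \<open>The difference of \<open>a\<close> and \<open>b\<close> is a multiple of
  \<open>f\<close>, which vanishes at every root. This makes \<open>lam \<mapsto> \<rho>\<close>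
  well defined.\<close>

lemma eval_cong:
  fixes a b :: "'p mod_ring poly"
  assumes "poly (fK a) lam = poly (fK b) lam" and "\<rho> \<in> R"
  shows "poly (fK a) \<rho> = poly (fK b) \<rho>"
proof -
  have "f dvd a - b" using assms(1)
    by (simp add: dvd_iff_eval_0 fK_simps)
  then obtain c where "a - b = f * c" ..
  then have "a = b + f * c" by (simp add: algebra_simps)
  then show ?thesis using assms(2) by (simp add: fK_simps)
qed

lemma frobenius_factor:
  obtains h where "Polynomial.monom 1 CARD('k) - Polynomial.monom 1 1 = f * h"
proof -
  have "poly (fK (Polynomial.monom 1 CARD('k) - Polynomial.monom 1 1 :: 'p mod_ring poly)) lam = 0"
    by (simp add: fK_simps poly_monom finite_field_power_card)
  then show ?thesis using that by (auto simp: dvd_iff_eval_0[symmetric] dvd_def)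
qed

lemma card_K_gt_1: "1 < CARD('k)"
  unfolding cardK using degree_pos prime_card[where 'a='p]
  by (intro one_less_power prime_gt_1_nat)

text \<open>Every field element is a root of \<open>X\<^sup>q - X = F * H\<close>, and
  \<open>H\<close> accounts for at most \<open>degree H\<close> of them, so \<open>F\<close> has at
  least \<open>n\<close> roots. At a root of \<open>F\<close> the derivative of the product is
  \<open>F' * H\<close>, which equals -1.\<close>

lemma roots_separable: "card R = n" "\<rho> \<in> R \<Longrightarrow> poly (pderiv F) \<rho> \<noteq> 0"
proof -
  let ?q = "CARD('k)"
  obtain h where h: "Polynomial.monom 1 ?q - Polynomial.monom 1 1 = f * h"
    by (rule frobenius_factor)
  define H :: "'k poly" where "H = fK h"
  define G :: "'k poly" where "G = Polynomial.monom 1 ?q - Polynomial.monom 1 1"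
  have "fK (Polynomial.monom 1 ?q - Polynomial.monom 1 1 :: 'p mod_ring poly) = F * H"
    by (simp only: h H_def fK_simps)
  then have GFH: "G = F * H"
    by (simp add: G_def fK_simps)
  have degG: "degree G = ?q"
    unfolding G_def diff_conv_add_uminus using card_K_gt_1
    by (subst degree_add_eq_left) (simp_all add: degree_monom_eq)
  then have "G \<noteq> 0" using card_K_gt_1 by auto
  then have nz: "F \<noteq> 0" "H \<noteq> 0" using GFH by auto
  have "poly G x = 0" for x
    by (simp add: G_def poly_monom finite_field_power_card)
  then have "UNIV = R \<union> {x. poly H x = 0}" by (auto simp: GFH)
  then have "?q \<le> card R + card {x. poly H x = 0}" by (metis card_Un_le)
  also have "card {x. poly H x = 0} \<le> degree H" by (rule card_poly_roots_bound[OF nz(2)])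
  finally have "?q \<le> card R + degree H" by simp
  moreover have "?q = n + degree H"
    using degG nz by (simp add: GFH degree_mult_eq degree_F)
  ultimately show "card R = n" using card_poly_roots_bound[OF nz(1)] by (simp add: degree_F)
  \<comment> \<open>The order is a positive power of p, so \<open>X\<^sup>q\<close> has derivative
    zero.\<close>
  have "(of_nat ?q :: 'k) = 0" using charK cardK degree_pos by simp
  then have "poly (pderiv G) \<rho> = - 1"
    by (simp add: G_def pderiv_diff pderiv_monom poly_monom)
  then show "poly (pderiv F) \<rho> \<noteq> 0" if "\<rho> \<in> R"
    using that by (auto simp: GFH pderiv_mult)
qed

section \<open>Bases of the field over \<open>Z_p\<close> and polynomial representatives\<close>

text \<open>Independence makes the map from coefficient families to the field injective; both sides
  have \<open>p^n\<close> elements, so it is onto.\<close>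

lemma spanning_if_independent:
  fixes b :: "nat \<Rightarrow> 'k"
  assumes indep: "\<And>c :: nat \<Rightarrow> 'p mod_ring. (\<Sum>i<n. emb (c i) * b i) = 0 \<Longrightarrow> \<forall>i<n. c i = 0"
  shows "\<exists>c. \<alpha> = (\<Sum>i<n. emb (c i :: 'p mod_ring) * b i)"
proof -
  \<comment> \<open>Extensional functions are fixed outside \<open>{..<n}\<close>, so exactly
    \<open>p^n\<close> families are counted.\<close>
  let ?S = "{..<n} \<rightarrow>\<^sub>E (UNIV :: 'p mod_ring set)"
  let ?T = "\<lambda>c :: nat \<Rightarrow> 'p mod_ring. \<Sum>i<n. emb (c i) * b i"
  have "inj_on ?T ?S"
  proof (rule inj_onI)
    fix c d assume cd: "c \<in> ?S" "d \<in> ?S" "?T c = ?T d"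
    then have "?T (\<lambda>i. c i - d i) = 0"
      by (simp add: emb.hom_minus left_diff_distrib sum_subtractf)
    from indep[OF this] have "\<forall>i<n. c i = d i" by simp
    with cd show "c = d" by (auto intro: PiE_ext)
  qed
  then have "card (?T ` ?S) = CARD('k)"
    by (simp add: card_image card_funcsetE cardK)
  then have "?T ` ?S = UNIV" by (simp add: card_eq_UNIV_imp_eq_UNIV)
  then have "\<alpha> \<in> ?T ` ?S" by simp
  then show ?thesis by auto
qed

lemma degree_sum_monom_less: "degree (\<Sum>i<n. Polynomial.monom (c i) i) < n"
  using degree_pos
  by (intro le_less_trans[OF degree_sum_le[where n = "n - 1"]])
     (auto intro!: order_trans[OF degree_monom_le])

text \<open>A relation is a polynomial of degree below \<open>n\<close> vanishing at
  \<open>lam\<close>, hence a multiple of \<open>f\<close>, hence zero.\<close>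

lemma power_basis_independent:
  fixes c :: "nat \<Rightarrow> 'p mod_ring"
  assumes "(\<Sum>i<n. emb (c i) * lam ^ i) = 0"
  shows "\<forall>i<n. c i = 0"
proof -
  define a where "a = (\<Sum>i<n. Polynomial.monom (c i) i)"
  have "poly (fK a) lam = 0"
    using assms by (simp add: a_def fK_simps poly_sum poly_monom)
  then have "f dvd a" by (simp add: dvd_iff_eval_0)
  moreover have "degree a < n" unfolding a_def by (rule degree_sum_monom_less)
  ultimately have "a = 0" using dvd_imp_degree_le leD by blast
  moreover have "Polynomial.coeff a i = c i" if "i < n" for i
    using that by (simp add: a_def coeff_sum)
  ultimately show ?thesis by auto
qed

lemma gf_rep_exists: "\<exists>a :: 'p mod_ring poly. degree a < n \<and> poly (fK a) lam = \<alpha>"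
proof -
  obtain c :: "nat \<Rightarrow> 'p mod_ring" where c: "\<alpha> = (\<Sum>i<n. emb (c i) * lam ^ i)"
    using spanning_if_independent[OF power_basis_independent] by blast
  define a where "a = (\<Sum>i<n. Polynomial.monom (c i) i)"
  have "poly (fK a) lam = \<alpha>"
    by (simp add: c a_def fK_simps poly_sum poly_monom)
  moreover have "degree a < n" unfolding a_def by (rule degree_sum_monom_less)
  ultimately show ?thesis by blast
qed

text \<open>Existence and uniqueness of the representative justify the definite description in
  \<open>gf_rep\<close>.\<close>

lemma gf_rep_eval: "poly (fK (gf_rep f lam \<alpha>)) lam = \<alpha>"
proof -
  have "a = b" if "degree a < n" "degree b < n" "poly (fK a) lam = poly (fK b) lam" for a b :: "'p mod_ring poly"
  proof -
    have "f dvd a - b" using that(3) by (simp add: dvd_iff_eval_0 fK_simps)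
    moreover have "degree (a - b) < n" using that by (simp add: degree_diff_less)
    ultimately have "a - b = 0" using dvd_imp_degree_le leD by blast
    then show ?thesis by simp
  qed
  then have "\<exists>!a :: 'p mod_ring poly. degree a < n \<and> poly (fK a) lam = \<alpha>"
    using gf_rep_exists by metis
  from theI'[OF this] show ?thesis by (simp add: gf_rep_def fK_def)
qed

section \<open>Conjugates and the trace\<close>

text \<open>For a root \<open>\<rho>\<close> this is the field homomorphism over \<open>Z_p\<close>
  sending \<open>lam\<close> to \<open>\<rho>\<close>. Going through \<open>gf_rep\<close> makes
  \<open>gf_tr\<close> the sum of these maps by definition.\<close>

definition conj_map :: "'k \<Rightarrow> 'k \<Rightarrow> 'k" where
  "conj_map \<rho> \<alpha> = poly (fK (gf_rep f lam \<alpha>)) \<rho>"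

lemma conj_map_eval:
  fixes a :: "'p mod_ring poly"
  shows "\<rho> \<in> R \<Longrightarrow> conj_map \<rho> (poly (fK a) lam) = poly (fK a) \<rho>"
  unfolding conj_map_def by (rule eval_cong[OF gf_rep_eval])

text \<open>The choice \<open>gf_rep\<close> need not be multiplicative, but by
  \<open>conj_map_eval\<close> any polynomial with the right value at \<open>lam\<close> may replace
  it.\<close>

lemma conj_map_hom:
  assumes "\<rho> \<in> R"
  shows "field_hom (conj_map \<rho>)"
proof -
  have ev: "conj_map \<rho> (poly (fK a) lam) = poly (fK a) \<rho>" for a :: "'p mod_ring poly"
    by (rule conj_map_eval[OF assms])
  have one: "conj_map \<rho> 1 = 1" using ev[of 1] by (simp add: fK_simps)
  have zero: "conj_map \<rho> 0 = 0" using ev[of 0] by (simp add: fK_simps)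
  have add: "conj_map \<rho> (\<alpha> + \<beta>) = conj_map \<rho> \<alpha> + conj_map \<rho> \<beta>" 
   and mult: "conj_map \<rho> (\<alpha> * \<beta>) = conj_map \<rho> \<alpha> * conj_map \<rho> \<beta>" for \<alpha> \<beta>
  proof -
    obtain a b :: "'p mod_ring poly" where ab: "\<alpha> = poly (fK a) lam" "\<beta> = poly (fK b) lam"
      by (metis gf_rep_eval)
    show "conj_map \<rho> (\<alpha> + \<beta>) = conj_map \<rho> \<alpha> + conj_map \<rho> \<beta>" 
      using ev[of "a + b"] ev[of a] ev[of b] by (simp add: ab fK_simps)
    show "conj_map \<rho> (\<alpha> * \<beta>) = conj_map \<rho> \<alpha> * conj_map \<rho> \<beta>" 
      using ev[of "a * b"] ev[of a] ev[of b] by (simp add: ab fK_simps)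
  qed
  show ?thesis by unfold_locales (simp_all add: one zero add mult)
qed

lemma conj_map_emb:
  fixes c :: "'p mod_ring"
  shows "\<rho> \<in> R \<Longrightarrow> conj_map \<rho> (emb c) = emb c"
  using conj_map_eval[of \<rho> "[:c:]"] by (simp add: fK_simps)

lemma conj_map_lam: "\<rho> \<in> R \<Longrightarrow> conj_map \<rho> lam = \<rho>"
  using conj_map_eval[of \<rho> "[:0, 1:]"] by (simp add: fK_simps)

lemma gf_tr_conj: "gf_tr f lam \<alpha> = (\<Sum>\<rho>\<in>R. conj_map \<rho> \<alpha>)"
  by (simp add: gf_tr_def conj_map_def fK_def)

lemma conj_map_simps:
  assumes "\<rho> \<in> R"
  shows "conj_map \<rho> 0 = 0" "conj_map \<rho> (\<alpha> - \<beta>) = conj_map \<rho> \<alpha> - conj_map \<rho> \<beta>"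
    "conj_map \<rho> (\<alpha> * \<beta>) = conj_map \<rho> \<alpha> * conj_map \<rho> \<beta>"
    "conj_map \<rho> (sum g A) = (\<Sum>i\<in>A. conj_map \<rho> (g i))"
    "conj_map \<rho> (\<alpha> ^ m) = conj_map \<rho> \<alpha> ^ m"
proof -
  interpret c: field_hom "conj_map \<rho>" by (rule conj_map_hom[OF assms])
  show "conj_map \<rho> 0 = 0" "conj_map \<rho> (\<alpha> - \<beta>) = conj_map \<rho> \<alpha> - conj_map \<rho> \<beta>"
    "conj_map \<rho> (\<alpha> * \<beta>) = conj_map \<rho> \<alpha> * conj_map \<rho> \<beta>"
    "conj_map \<rho> (sum g A) = (\<Sum>i\<in>A. conj_map \<rho> (g i))"
    "conj_map \<rho> (\<alpha> ^ m) = conj_map \<rho> \<alpha> ^ m"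
    by (simp_all only: c.hom_zero c.hom_minus c.hom_mult c.hom_sum c.hom_power)
qed

lemma gf_tr_0: "gf_tr f lam 0 = 0"
  unfolding gf_tr_conj by (intro sum.neutral ballI conj_map_simps)

lemma gf_tr_diff: "gf_tr f lam (\<alpha> - \<beta>) = gf_tr f lam \<alpha> - gf_tr f lam \<beta>"
  unfolding gf_tr_conj sum_subtractf[symmetric]
  by (intro sum.cong refl conj_map_simps)

lemma gf_tr_sum: "gf_tr f lam (sum g A) = (\<Sum>i\<in>A. gf_tr f lam (g i))"
  unfolding gf_tr_conj by (subst sum.swap) (intro sum.cong refl conj_map_simps)

lemma gf_tr_scale:
  fixes c :: "'p mod_ring"
  shows "gf_tr f lam (emb c * \<alpha>) = emb c * gf_tr f lam \<alpha>"
  unfolding gf_tr_conj sum_distrib_left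
  by (rule sum.cong[OF refl]) (simp only: conj_map_simps conj_map_emb)

section \<open>Trace-dual bases and coordinates\<close>

definition dual_basis :: "nat \<Rightarrow> 'k" where
  "dual_basis j = dcoef f lam j * inverse (poly (pderiv F) lam)"

lemma evec_eq: "evec f lam j = (dual_basis j, 0)"
  by (simp add: evec_def dual_basis_def)

text \<open>Field homomorphisms commute with polynomial division, derivation and evaluation; this
  one fixes the coefficients of \<open>F\<close> and moves \<open>lam\<close> to
  \<open>\<rho>\<close>.\<close>

lemma conj_map_dual_basis:
  assumes \<rho>: "\<rho> \<in> R"
  shows "conj_map \<rho> (dual_basis j)
    = Polynomial.coeff (F div [:- \<rho>, 1:]) j * inverse (poly (pderiv F) \<rho>)"
proof -
  interpret c: field_hom "conj_map \<rho>" by (rule conj_map_hom[OF \<rho>])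
  have F: "map_poly (conj_map \<rho>) F = F"
    by (rule poly_eqI) (simp add: fK_def conj_map_emb[OF \<rho>])
  have "map_poly (conj_map \<rho>) (F div [:- lam, 1:]) = F div [:- \<rho>, 1:]"
    by (simp add: c.map_poly_div F c.map_poly_pCons_hom c.hom_uminus conj_map_lam[OF \<rho>])
  then have "conj_map \<rho> (dcoef f lam j) = Polynomial.coeff (F div [:- \<rho>, 1:]) j"
    unfolding dcoef_def by (metis c.coeff_map_poly_hom)
  moreover have "conj_map \<rho> (poly (pderiv F) lam) = poly (pderiv F) \<rho>"
    using c.poly_map_poly[of "pderiv F" lam] 
    by (simp add: c.map_poly_pderiv F conj_map_lam[OF \<rho>])
  ultimately show ?thesis by (simp add: dual_basis_def c.hom_mult c.hom_inverse)
qed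

text \<open>The conjugates of \<open>dual_basis j * lam ^ k\<close> are the summands of
  \<open>euler_interpolation\<close>.\<close>

lemma gf_tr_dual_basis:
  assumes "k < n"
  shows "gf_tr f lam (dual_basis j * lam ^ k) = (if j = k then 1 else 0)"
proof -
  have "gf_tr f lam (dual_basis j * lam ^ k)
    = (\<Sum>\<rho>\<in>R. Polynomial.coeff (F div [:- \<rho>, 1:]) j * inverse (poly (pderiv F) \<rho>) * \<rho> ^ k)"
    unfolding gf_tr_conj
    by (rule sum.cong[OF refl]) (simp only: conj_map_simps conj_map_dual_basis conj_map_lam)
  also have "\<dots> = (if j = k then 1 else 0)"
    using roots_separable assms by (intro euler_interpolation) (simp_all only: degree_F mem_Collect_eq not_False_eq_True)
  finally show ?thesis .
qed

text \<open>The trace is linear over \<open>Z_p\<close>, and duality leaves only the diagonal of the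
  double sum.\<close>

lemma gf_tr_dual_expansion:
  fixes x y :: "nat \<Rightarrow> 'p mod_ring"
  shows "gf_tr f lam ((\<Sum>j<n. emb (x j) * dual_basis j) * (\<Sum>k<n. emb (y k) * lam ^ k))
   = emb (\<Sum>i<n. x i * y i)"
proof -
  have "gf_tr f lam ((\<Sum>j<n. emb (x j) * dual_basis j) * (\<Sum>k<n. emb (y k) * lam ^ k))
    = (\<Sum>j<n. \<Sum>k<n. gf_tr f lam (emb (x j * y k) * (dual_basis j * lam ^ k)))"
    unfolding sum_product gf_tr_sum by (simp only: emb.hom_mult mult_ac)
  also have "\<dots> = (\<Sum>j<n. \<Sum>k<n. if j = k then emb (x j * y k) else 0)"
    by (intro sum.cong refl) (simp only: gf_tr_scale, simp add: gf_tr_dual_basis)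
  also have "\<dots> = emb (\<Sum>i<n. x i * y i)"
    by (simp add: emb.hom_sum)
  finally show ?thesis .
qed

text \<open>Taking the trace of a relation times \<open>lam ^ k\<close> isolates its coefficient at
  \<open>k\<close>.\<close>

lemma dual_basis_independent:
  fixes c :: "nat \<Rightarrow> 'p mod_ring"
  assumes "(\<Sum>i<n. emb (c i) * dual_basis i) = 0"
  shows "\<forall>i<n. c i = 0"
proof (intro allI impI)
  fix k assume k: "k < n"
  let ?y = "\<lambda>i. if i = k then 1 else 0 :: 'p mod_ring"
  have "emb (\<Sum>i<n. c i * ?y i) = (0::'k)"
    by (subst gf_tr_dual_expansion[symmetric]) (simp add: assms gf_tr_0)
  then have "(\<Sum>i<n. c i * ?y i) = 0" by simp
  also have "(\<Sum>i<n. c i * ?y i) = c k" using k by (simp add: sum.delta if_distrib cong: if_cong)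
  finally show "c k = 0" .
qed

text \<open>This is the inverse of \<open>M\<close>.\<close>

definition coord_vec :: "(nat \<Rightarrow> 'p mod_ring) \<Rightarrow> 'k \<times> 'k" where
  "coord_vec w = (\<Sum>j<n. emb (w (2*j)) * dual_basis j, \<Sum>j<n. emb (w (2*j+1)) * lam ^ j)"

lemma coord_vec_add: "coord_vec (\<lambda>i. w i + w' i) = coord_vec w + coord_vec w'"
  by (simp add: coord_vec_def emb.hom_add distrib_right sum.distrib)

lemma coord_vec_scale:
  "coord_vec (\<lambda>i. c * w i) = (emb c * fst (coord_vec w), emb c * snd (coord_vec w))"
  by (simp add: coord_vec_def emb.hom_mult sum_distrib_left mult.assoc)

lemma coord_vec_unitv:
  assumes "j < n"
  shows "coord_vec (unitv (2*j)) = evec f lam j" "coord_vec (unitv (2*j+1)) = fvec lam j"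
proof -
  have emb_delta: "emb (if P then 1 else 0 :: 'p mod_ring) * x = (if P then x else 0)" for P and x :: 'k
    by simp
  have "2 * i \<noteq> Suc (2 * j)" "Suc (2 * i) \<noteq> 2 * j" for i by presburger+
  then show "coord_vec (unitv (2*j)) = evec f lam j" "coord_vec (unitv (2*j+1)) = fvec lam j"
    using assms by (simp_all add: coord_vec_def unitv_def evec_eq fvec_def emb_delta)
qed

lemma coord_vec_inj: "inj_on coord_vec (V2n n)"
proof (rule inj_onI)
  fix w w' assume w: "w \<in> V2n n" "w' \<in> V2n n" and eq: "coord_vec w = coord_vec w'"
  have even_eq: "\<forall>j<n. w (2*j) - w' (2*j) = 0"
    by (rule dual_basis_independent)
       (use eq in \<open>simp add: coord_vec_def emb.hom_minus left_diff_distrib sum_subtractf\<close>)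
  have odd_eq: "\<forall>j<n. w (2*j+1) - w' (2*j+1) = 0"
    by (rule power_basis_independent)
       (use eq in \<open>simp add: coord_vec_def emb.hom_minus left_diff_distrib sum_subtractf\<close>)
  show "w = w'"
  proof
    fix i
    consider j where "j < n" "i = 2 * j" | j where "j < n" "i = 2 * j + 1" | "2 * n \<le> i"
    proof (cases "i < 2 * n")
      case True
      then have "i div 2 < n" by auto
      moreover have "i = 2 * (i div 2) \<or> i = 2 * (i div 2) + 1" by presburger
      ultimately show ?thesis using that by blast
    qed (use that in auto)
    then show "w i = w' i" by cases (use even_eq odd_eq w in \<open>auto simp: V2n_def\<close>)
  qed
qed

lemma coord_vec_surj: "\<exists>w\<in>V2n n. coord_vec w = u"
proof -
  obtain x where x: "fst u = (\<Sum>j<n. emb (x j :: 'p mod_ring) * dual_basis j)"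
    using spanning_if_independent[OF dual_basis_independent] by blast
  obtain y where y: "snd u = (\<Sum>j<n. emb (y j :: 'p mod_ring) * lam ^ j)"
    using spanning_if_independent[OF power_basis_independent] by blast
  \<comment> \<open>Even positions hold coordinates in the dual basis, odd ones those in the power
    basis; the zeros from \<open>2 * n\<close> on put \<open>w\<close> into
    \<open>V2n n\<close>.\<close>
  define w where
    "w i = (if i < 2 * n then if even i then x (i div 2) else y (i div 2) else 0)" for i
  have "w \<in> V2n n" by (simp add: w_def V2n_def)
  moreover have "coord_vec w = u"
    by (rule prod_eqI) (simp_all add: coord_vec_def x y w_def)
  ultimately show ?thesis by blast
qed

text \<open>Each term of \<open>symK\<close> multiplies a first component, expanded in the dual
  basis, by a second one, expanded in the power basis; its trace is the dot product of the
  coordinates.\<close>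

lemma symZ_eq_trace:
  "emb (symZ n w w') = gf_tr f lam (symK (coord_vec w) (coord_vec w'))"
proof -
  have "symK (coord_vec w) (coord_vec w') =
     fst (coord_vec w') * snd (coord_vec w) - fst (coord_vec w) * snd (coord_vec w')"
    by (simp add: symK_def mult.commute)
  also have "gf_tr f lam \<dots> = emb (\<Sum>i<n. w' (2*i) * w (2*i+1)) - emb (\<Sum>i<n. w (2*i) * w' (2*i+1))"
    unfolding gf_tr_diff coord_vec_def fst_conv snd_conv gf_tr_dual_expansion ..
  also have "\<dots> = emb (symZ n w w')"
    unfolding symZ_def emb.hom_minus[symmetric] sum_subtractf[symmetric] by (simp only: mult.commute)
  finally show ?thesis ..
qed

section \<open>The isomorphism \<open>M\<close> and the images of the lines\<close>

text \<open>Only the conditions that define \<open>M\<close>; bijectivity and the trace identity are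
  consequences.\<close>

definition symplectic_iso :: "('k \<times> 'k \<Rightarrow> nat \<Rightarrow> 'p mod_ring) \<Rightarrow> bool" where
  "symplectic_iso M \<longleftrightarrow> Zp_linear M \<and>
     (\<forall>j<n. M (evec f lam j) = unitv (2*j)) \<and> (\<forall>j<n. M (fvec lam j) = unitv (2*j+1))"

text \<open>The inverse of \<open>coord_vec\<close> on \<open>V2n n\<close> inherits linearity, and
  \<open>coord_vec_unitv\<close> gives its values on the basis.\<close>

lemma symplectic_iso_exists: "\<exists>M. symplectic_iso M"
proof
  define M where "M = inv_into (V2n n) coord_vec"
  have MT: "M (coord_vec w) = w" if "w \<in> V2n n" for w
    unfolding M_def by (rule inv_into_f_f[OF coord_vec_inj that])
  have "Zp_linear M" unfolding Zp_linear_def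
  proof (intro conjI allI)
    fix u v :: "'k \<times> 'k"
    obtain w w' where w: "w \<in> V2n n" "coord_vec w = u" and w': "w' \<in> V2n n" "coord_vec w' = v"
      using coord_vec_surj by meson
    have "(\<lambda>i. w i + w' i) \<in> V2n n" using w w' by (simp add: V2n_def)
    moreover have "coord_vec (\<lambda>i. w i + w' i) = (fst u + fst v, snd u + snd v)"
      by (simp add: coord_vec_add w w' plus_prod_def)
    ultimately show "M (fst u + fst v, snd u + snd v) = (\<lambda>i. M u i + M v i)"
      using MT w w' by metis
  next
    fix c :: "'p mod_ring" and u :: "'k \<times> 'k"
    obtain w where w: "w \<in> V2n n" "coord_vec w = u" using coord_vec_surj by meson
    have "(\<lambda>i. c * w i) \<in> V2n n" using w by (simp add: V2n_def)
    moreover have "coord_vec (\<lambda>i. c * w i) = (emb c * fst u, emb c * snd u)"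
      by (simp add: coord_vec_scale w)
    ultimately show "M (emb c * fst u, emb c * snd u) = (\<lambda>i. c * M u i)"
      using MT w by metis
  qed
  moreover have "unitv (2*j) \<in> V2n n" "unitv (2*j+1) \<in> V2n n" if "j < n" for j
    using that by (auto simp: V2n_def unitv_def)
  ultimately show "symplectic_iso M" unfolding symplectic_iso_def
    using MT coord_vec_unitv by metis
qed

lemma symplectic_iso_add: "symplectic_iso M \<Longrightarrow> M (u + v) = (\<lambda>i. M u i + M v i)"
  by (simp add: symplectic_iso_def Zp_linear_def plus_prod_def)

lemma symplectic_iso_scale:
  "symplectic_iso M \<Longrightarrow> M (emb c * fst u, emb c * snd u) = (\<lambda>i. c * M u i)"
  by (simp add: symplectic_iso_def Zp_linear_def)

lemma symplectic_iso_0: "symplectic_iso M \<Longrightarrow> M 0 = (\<lambda>i. 0)"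
  using symplectic_iso_scale[of M 0 0] by (simp add: zero_prod_def)

lemma symplectic_iso_sum:
  assumes "symplectic_iso M"
  shows "M (sum g A) = (\<lambda>i. \<Sum>j\<in>A. M (g j) i)"
  by (induction A rule: infinite_finite_induct)
     (simp_all add: symplectic_iso_0[OF assms] symplectic_iso_add[OF assms])

text \<open>A linear map is determined by its values on the \<open>e_j\<close> and
  \<open>f_j\<close>, so every admissible \<open>M\<close> inverts \<open>coord_vec\<close>.\<close>

lemma symplectic_iso_coord_vec:
  assumes M: "symplectic_iso M" and w: "w \<in> V2n n"
  shows "M (coord_vec w) = w"
proof
  fix i
  let ?e = "\<lambda>j. (emb (w (2*j)) * fst (evec f lam j), emb (w (2*j)) * snd (evec f lam j))"
  let ?f = "\<lambda>j. (emb (w (2*j+1)) * fst (fvec lam j), emb (w (2*j+1)) * snd (fvec lam j))"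
  have "coord_vec w = (\<Sum>j<n. ?e j) + (\<Sum>j<n. ?f j)"
    by (rule prod_eqI) (simp_all add: coord_vec_def evec_eq fvec_def fst_sum snd_sum)
  then have "M (coord_vec w) i = (\<Sum>j<n. M (?e j) i) + (\<Sum>j<n. M (?f j) i)"
    by (simp only: symplectic_iso_add[OF M] symplectic_iso_sum[OF M])
  also have "\<dots> = (\<Sum>j<n. w (2*j) * unitv (2*j) i) + (\<Sum>j<n. w (2*j+1) * unitv (2*j+1) i)"
    using M by (simp only: symplectic_iso_scale[OF M]) (simp add: symplectic_iso_def)
  \<comment> \<open>The parity of \<open>i\<close> decides which sum contributes; from
    \<open>2 * n\<close> on both vanish, as does \<open>w i\<close>.\<close>
  also have "\<dots> = w i"
  proof (cases "even i")
    case True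
    then obtain m where m: "i = 2 * m" ..
    have "(\<Sum>j<n. w (2*j) * unitv (2*j) i) = (\<Sum>j<n. if m = j then w i else 0)"
      by (rule sum.cong) (auto simp: unitv_def m)
    moreover have "(\<Sum>j<n. w (2*j+1) * unitv (2*j+1) i) = 0"
      using True by (intro sum.neutral) (auto simp: unitv_def)
    ultimately show ?thesis using w m by (auto simp: V2n_def)
  next
    case False
    then obtain m where m: "i = 2 * m + 1" by (rule oddE)
    have "(\<Sum>j<n. w (2*j+1) * unitv (2*j+1) i) = (\<Sum>j<n. if m = j then w i else 0)"
      by (rule sum.cong) (auto simp: unitv_def m)
    moreover have "(\<Sum>j<n. w (2*j) * unitv (2*j) i) = 0"
      using False by (intro sum.neutral) (auto simp: unitv_def)
    ultimately show ?thesis using w m by (auto simp: V2n_def)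
  qed
  finally show "M (coord_vec w) i = w i" .
qed

lemma coord_vec_symplectic_iso:
  assumes "symplectic_iso M"
  shows "M u \<in> V2n n" "coord_vec (M u) = u"
  using coord_vec_surj[of u] symplectic_iso_coord_vec[OF assms] by auto

lemma symplectic_iso_bij:
  assumes "symplectic_iso M"
  shows "bij_betw M UNIV (V2n n)"
  by (rule bij_betw_byWitness[where f' = coord_vec])
     (auto simp: coord_vec_symplectic_iso[OF assms] symplectic_iso_coord_vec[OF assms])

lemma symplectic_iso_trace:
  assumes "symplectic_iso M"
  shows "emb (symZ n (M u) (M v)) = gf_tr f lam (symK u v)"
  by (simp add: symZ_eq_trace coord_vec_symplectic_iso[OF assms])

text \<open>On a line \<open>symK\<close> vanishes even before the trace is taken, and
  \<open>emb\<close> is injective.\<close>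

lemma symplectic_iso_symZ_Cset:
  assumes "symplectic_iso M" "w \<in> M ` Cset a" "w' \<in> M ` Cset a"
  shows "symZ n w w' = 0"
proof -
  obtain u v where "u \<in> Cset a" "v \<in> Cset a" "w = M u" "w' = M v" using assms(2,3) by blast
  then have "emb (symZ n w w') = (0::'k)"
    by (simp add: symplectic_iso_trace[OF assms(1)] symK_Cset gf_tr_0)
  then show ?thesis by simp
qed

lemma symplectic_iso_subspace:
  assumes M: "symplectic_iso M"
  shows "Zp_subspace n (M ` Cset a)"
  unfolding Zp_subspace_def
proof (intro conjI ballI allI)
  show "M ` Cset a \<subseteq> V2n n" using coord_vec_symplectic_iso[OF M] by auto
  show "(\<lambda>i. 0) \<in> M ` Cset a"
    using symplectic_iso_0[OF M] Cset_0 by (metis imageI)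
next
  fix w w' assume "w \<in> M ` Cset a" "w' \<in> M ` Cset a"
  then obtain u v where "u \<in> Cset a" "v \<in> Cset a" "w = M u" "w' = M v" by blast
  then show "(\<lambda>i. w i + w' i) \<in> M ` Cset a"
    using symplectic_iso_add[OF M, of u v] Cset_add[of u a v] by (metis imageI)
next
  fix c w assume "w \<in> M ` Cset a"
  then obtain u where "u \<in> Cset a" "w = M u" by blast
  then show "(\<lambda>i. c * w i) \<in> M ` Cset a"
    using symplectic_iso_scale[OF M, of c u] Cset_scale[of u a "emb c"] by (metis imageI)
qed

lemma symplectic_iso_Cset_inter:
  assumes M: "symplectic_iso M" and "a \<noteq> b"
  shows "M ` Cset a \<inter> M ` Cset b = {\<lambda>i. 0}"
proof -
  have "inj M" using symplectic_iso_bij[OF M] by (simp add: bij_betw_def)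
  then have "M ` Cset a \<inter> M ` Cset b = M ` (Cset a \<inter> Cset b)" by (rule image_Int[symmetric])
  then show ?thesis using assms by (simp add: Cset_inter symplectic_iso_0)
qed

lemma symplectic_iso_card_Cset:
  assumes M: "symplectic_iso M"
  shows "card (M ` Cset a) = CARD('p) ^ n"
proof -
  have "inj_on M (Cset a)"
    using symplectic_iso_bij[OF M] by (auto simp: bij_betw_def intro: inj_on_subset)
  then show ?thesis by (simp add: card_image card_Cset cardK)
qed

text \<open>Equal images of different lines would equal their intersection, the zero space, but each
  has more than one element. The index \<open>None\<close> adds one to the order of the
  field.\<close>

lemma symplectic_iso_card_spread:
  assumes M: "symplectic_iso M"
  shows "card (range (\<lambda>a. M ` Cset a)) = CARD('p) ^ n + 1"
proof -
  have "inj (\<lambda>a. M ` Cset a)"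
  proof (rule injI, rule ccontr)
    fix a b assume "M ` Cset a = M ` Cset b" "a \<noteq> b"
    then have "M ` Cset a = {\<lambda>i. 0}" using symplectic_iso_Cset_inter[OF M] by blast
    then have "CARD('k) = 1" using symplectic_iso_card_Cset[OF M, of a] by (simp add: cardK)
    then show False using card_K_gt_1 by simp
  qed
  then have "card (range (\<lambda>a. M ` Cset a)) = card (UNIV :: 'k option set)"
    by (rule card_image)
  also have "\<dots> = CARD('k) + 1"
    by (simp add: UNIV_option_conv card_image)
  finally show ?thesis by (simp only: cardK)
qed

end

section \<open>Phases and commutation of the tensor operators\<close>

text \<open>The power \<open>\<eta>^k\<close> with integer exponent, so that phases multiply by
  adding exponents.\<close>

definition omega :: "nat \<Rightarrow> int \<Rightarrow> complex" where
  "omega p k = cis (2 * pi * real_of_int k / real p)"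

lemma omega_add: "omega p (k + l) = omega p k * omega p l"
  by (simp add: omega_def cis_mult add_divide_distrib distrib_left)

lemma omega_sum: "omega p (sum g A) = (\<Prod>i\<in>A. omega p (g i))"
proof -
  have "omega p 0 = 1" by (simp add: omega_def)
  then show ?thesis
    by (induction A rule: infinite_finite_induct) (simp_all add: omega_add)
qed

lemma omega_cong:
  assumes "0 < p" "int p dvd k - l"
  shows "omega p k = omega p l"
proof -
  obtain t where "k = l + int p * t" using assms(2) by (metis dvd_def diff_add_cancel add.commute)
  then have "omega p k = omega p l * cis (2 * pi * real_of_int t)"
    using assms(1) by (simp add: omega_def cis_mult field_simps)
  also have "cis (2 * pi * real_of_int t) = 1" by (rule cis_multiple_2pi) simp
  finally show ?thesis by simp
qed

lemma finite_tidx: "finite (tidx n p)"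
proof -
  have "tidx n p = {g. \<forall>i. (i \<in> {..<n} \<longrightarrow> g i \<in> {..<p}) \<and> (i \<notin> {..<n} \<longrightarrow> g i = 0)}"
    unfolding tidx_def by (simp only: lessThan_iff not_less)
  then show ?thesis by (simp only: finite_set_of_finite_funs finite_lessThan)
qed

text \<open>A product of entries vanishes once a factor does, so within
  \<open>tidx n CARD('p)\<close> a row has a single nonzero entry, whose phases merge into one
  exponent.\<close>

lemma tensorS_eq:
  fixes w :: "nat \<Rightarrow> 'p::prime_card mod_ring"
  shows "tensorS n w a b =
    (if \<forall>i<n. b i = (a i + nat (to_int_mod_ring (w (2*i+1)))) mod CARD('p)
     then omega CARD('p) (\<Sum>i<n. int (a i) * to_int_mod_ring (w (2*i))) else 0)"
proof -
  have S: "Sop x y m m' = (if m' = (m + nat (to_int_mod_ring y)) mod CARD('p)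
      then omega CARD('p) (int m * to_int_mod_ring x) else 0)" for x y :: "'p mod_ring" and m m'
    by (simp add: Sop_def omega_def mult.assoc)
  show ?thesis
    unfolding tensorS_def omega_sum S by auto
qed

lemma to_int_mod_ring_nonneg: "0 \<le> to_int_mod_ring (x :: 'a::finite mod_ring)"
  using range_to_int_mod_ring[where 'a='a] by (metis atLeastLessThan_iff rangeI)

text \<open>The shifts compose. The second phase is read at the index already moved by the first
  shift, which produces the cross term of \<open>w (2*i+1)\<close> and
  \<open>w' (2*i)\<close>.\<close>

lemma tmult_tensorS:
  fixes w w' :: "nat \<Rightarrow> 'p::prime_card mod_ring"
  assumes a: "a \<in> tidx n CARD('p)"
  shows "tmult (tidx n CARD('p)) (tensorS n w) (tensorS n w') a b =
    (if \<forall>i<n. b i = (a i + nat (to_int_mod_ring (w (2*i+1))) + nat (to_int_mod_ring (w' (2*i+1)))) mod CARD('p)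
     then omega CARD('p) (\<Sum>i<n. int (a i) * to_int_mod_ring (w (2*i))
       + (int (a i) + to_int_mod_ring (w (2*i+1))) * to_int_mod_ring (w' (2*i))) else 0)"
proof -
  let ?p = "CARD('p)" and ?I = "tidx n CARD('p)"
  have p: "0 < ?p" by simp
  \<comment> \<open>The column of the only nonzero entry in row \<open>a\<close> of
    \<open>tensorS n w\<close>; the zeros from \<open>n\<close> on put it into
    \<open>?I\<close>.\<close>
  define k where "k i = (if i < n then (a i + nat (to_int_mod_ring (w (2*i+1)))) mod ?p else 0)" for i
  have k: "k \<in> ?I" by (auto simp: k_def tidx_def)
  have "tensorS n w a c = 0" if "c \<in> ?I" "c \<noteq> k" for c
  proof -
    from \<open>c \<noteq> k\<close> obtain i where i: "c i \<noteq> k i" by auto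
    moreover have "i < n"
    proof (rule ccontr)
      assume "\<not> i < n"
      then show False using i that(1) by (simp add: tidx_def k_def)
    qed
    ultimately show ?thesis by (auto simp: tensorS_eq k_def)
  qed
  then have "tmult ?I (tensorS n w) (tensorS n w') a b = tensorS n w a k * tensorS n w' k b"
    unfolding tmult_def using k
    by (subst sum.mono_neutral_right[OF finite_tidx, of "{k}"]) auto
  moreover have "tensorS n w a k = omega ?p (\<Sum>i<n. int (a i) * to_int_mod_ring (w (2*i)))"
    by (simp add: tensorS_eq k_def)
  moreover have "tensorS n w' k b =
    (if \<forall>i<n. b i = (a i + nat (to_int_mod_ring (w (2*i+1))) + nat (to_int_mod_ring (w' (2*i+1)))) mod ?p
     then omega ?p (\<Sum>i<n. (int (a i) + to_int_mod_ring (w (2*i+1))) * to_int_mod_ring (w' (2*i))) else 0)"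
  proof -
    \<comment> \<open>Reducing the shifted index mod p changes the exponent by a multiple of p
      only.\<close>
    have "omega ?p (\<Sum>i<n. int (k i) * to_int_mod_ring (w' (2*i)))
      = omega ?p (\<Sum>i<n. (int (a i) + to_int_mod_ring (w (2*i+1))) * to_int_mod_ring (w' (2*i)))"
    proof (rule omega_cong[OF p], unfold sum_subtractf[symmetric], rule dvd_sum)
      fix i assume "i \<in> {..<n}"
      then have "int (k i) = (int (a i) + to_int_mod_ring (w (2*i+1))) mod int ?p"
        by (simp add: k_def zmod_int to_int_mod_ring_nonneg)
      then have "int ?p dvd int (k i) - (int (a i) + to_int_mod_ring (w (2*i+1)))"
        by (simp add: mod_eq_dvd_iff[symmetric])
      then show "int ?p dvd int (k i) * to_int_mod_ring (w' (2*i))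
          - (int (a i) + to_int_mod_ring (w (2*i+1))) * to_int_mod_ring (w' (2*i))"
        by (metis dvd_mult2 left_diff_distrib)
    qed
    moreover have "(\<forall>i<n. b i = (k i + nat (to_int_mod_ring (w' (2*i+1)))) mod ?p) \<longleftrightarrow>
      (\<forall>i<n. b i = (a i + nat (to_int_mod_ring (w (2*i+1))) + nat (to_int_mod_ring (w' (2*i+1)))) mod ?p)"
      by (simp add: k_def mod_add_left_eq)
    ultimately show ?thesis by (simp only: tensorS_eq)
  qed
  ultimately show ?thesis
    by (auto simp only: sum.distrib omega_add mult_zero_right split: if_split)
qed

text \<open>Both orders give the same total shift. Their exponents differ by the symplectic product
  of integer representatives, as the terms with \<open>a i\<close> cancel.\<close>

lemma ops_commute_if_symZ_eq_0:
  fixes w w' :: "nat \<Rightarrow> 'p::prime_card mod_ring"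
  assumes "symZ n w w' = 0"
  shows "ops_commute n CARD('p) (tensorS n w) (tensorS n w')"
  unfolding ops_commute_def
proof (intro ballI)
  fix a b assume a: "a \<in> tidx n CARD('p)"
  let ?t = "to_int_mod_ring :: 'p mod_ring \<Rightarrow> int"
  have of_int_t: "of_int (?t x) = x" for x
    by (simp add: of_int_of_int_mod_ring)
  \<comment> \<open>The integer sum reduces to \<open>symZ n w w'\<close> in \<open>Z_p\<close>, so
    its vanishing there means divisibility by p.\<close>
  have "of_int (\<Sum>i<n. ?t (w (2*i+1)) * ?t (w' (2*i)) - ?t (w (2*i)) * ?t (w' (2*i+1))) = symZ n w w'"
    by (simp add: symZ_def of_int_t)
  then have "int CARD('p) dvd (\<Sum>i<n. ?t (w (2*i+1)) * ?t (w' (2*i)) - ?t (w (2*i)) * ?t (w' (2*i+1)))"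
    unfolding assms of_int_eq_0_iff_char_dvd semiring_char_mod_ring .
  also have "\<dots> = (\<Sum>i<n. int (a i) * ?t (w (2*i)) + (int (a i) + ?t (w (2*i+1))) * ?t (w' (2*i)))
    - (\<Sum>i<n. int (a i) * ?t (w' (2*i)) + (int (a i) + ?t (w' (2*i+1))) * ?t (w (2*i)))"
    unfolding sum_subtractf[symmetric] by (simp add: algebra_simps)
  finally have phase_eq: "omega CARD('p) (\<Sum>i<n. int (a i) * ?t (w (2*i)) + (int (a i) + ?t (w (2*i+1))) * ?t (w' (2*i)))
    = omega CARD('p) (\<Sum>i<n. int (a i) * ?t (w' (2*i)) + (int (a i) + ?t (w' (2*i+1))) * ?t (w (2*i)))"
    by (rule omega_cong[rotated]) simp
  show "tmult (tidx n CARD('p)) (tensorS n w) (tensorS n w') a b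
    = tmult (tidx n CARD('p)) (tensorS n w') (tensorS n w) a b"
    unfolding tmult_tensorS[OF a] phase_eq by (simp only: ac_simps)
qed

theorem mainTheorem13:
  fixes f :: "'p::prime_card mod_ring poly" and lam :: "'k::{field,finite}"
  assumes irr: "irreducible f" and mon: "monic f"
    and cardK: "CARD('k) = CARD('p) ^ degree f"
    and charK: "of_nat CARD('p) = (0::'k)"
    and root: "poly (fK f) lam = 0"
  shows
   "(\<exists>M :: 'k \<times> 'k \<Rightarrow> nat \<Rightarrow> 'p mod_ring. Zp_linear M \<and>
       (\<forall>j<degree f. M (evec f lam j) = unitv (2*j)) \<and>
       (\<forall>j<degree f. M (fvec lam j) = unitv (2*j+1))) \<and>
    (\<forall>M :: 'k \<times> 'k \<Rightarrow> nat \<Rightarrow> 'p mod_ring. Zp_linear M \<and>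
       (\<forall>j<degree f. M (evec f lam j) = unitv (2*j)) \<and>
       (\<forall>j<degree f. M (fvec lam j) = unitv (2*j+1)) \<longrightarrow>
       bij_betw M UNIV (V2n (degree f)) \<and>
       (\<forall>u1 u2. emb (symZ (degree f) (M u1) (M u2)) = gf_tr f lam (symK u1 u2)) \<and>
       card ((\<lambda>a. M ` Cset a) ` UNIV) = CARD('p) ^ degree f + 1 \<and>
       (\<forall>a b. a \<noteq> b \<longrightarrow> M ` Cset a \<inter> M ` Cset b = {\<lambda>i. 0}) \<and>
       (\<forall>a. Zp_subspace (degree f) (M ` Cset a) \<and>
            card (M ` Cset a) = CARD('p) ^ degree f \<and>
            (\<forall>w\<in>M ` Cset a. \<forall>w'\<in>M ` Cset a. symZ (degree f) w w' = 0) \<and>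
            (\<forall>w\<in>M ` Cset a. \<forall>w'\<in>M ` Cset a.
               ops_commute (degree f) CARD('p) (tensorS (degree f) w) (tensorS (degree f) w'))))"
  proof -
  interpret gf_extension f lam by unfold_locales (fact assms)+
  show ?thesis
    \<comment> \<open>Once the conditions on \<open>M\<close> are folded, each conjunct is an
      instance of one lemma.\<close>
    unfolding symplectic_iso_def[symmetric]
    by (intro conjI allI impI ballI;
        (rule symplectic_iso_exists symplectic_iso_bij symplectic_iso_trace
          symplectic_iso_card_spread symplectic_iso_Cset_inter symplectic_iso_subspace
          symplectic_iso_card_Cset symplectic_iso_symZ_Cset
          ops_commute_if_symZ_eq_0[OF symplectic_iso_symZ_Cset]; assumption))
qed

end
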